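(* Consider instances of Max Ext-Representation in which every candidate is a voter and approves of at least one candidate other than themselves. On such instances the greedy algorithm achieves approximation ratio $\frac{e-1}{e+1}$, i.e. its committee $A_p$ satisfies $ext(A_p) \geq \frac{e-1}{e+1}\max_{C\subseteq Z,|C|=p} ext(C)$.
   Context: Election setting: voters $X$, candidates $Z$; each voter approves of a subset of $Z$, and $S_j\subseteq X$ is the set of voters approving candidate $c_j$. For a committee $C\subseteq Z$, the number of externally represented voters is $ext(C) = \left|\bigcup_{c_j\in C} S_j \setminus C\right|$ (voters approving of some committee member, excluding the committee members). Max Ext-Representation: given $p$, find $C\subseteq Z$ with $|C|=p$ maximizing $ext(C)$. Let $\widetilde{rep}(C) = \left|\bigcup_{c_j\in C} S_j \cup C\right|$ (represented voters when every candidate is regarded as approving of themselves); note $ext(C) = \widetilde{rep}(C)-|C|$. The greedy algorithm starts from $A_0=\emptyset$ and sets $A_{i+1} = A_i\cup\{\arg\max_{c\in Z\setminus A_i}\widetilde{rep}(A_i\cup\{c\})\}$ for $i<p$, returning $A_p$. *)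

theory Defs
  imports Complex_Main
begin

text \<open>
  Voters and candidates live in a common type, since a candidate may also be a voter.
  A ballot profile \<open>B\<close> maps a voter to the set of candidates the voter approves of.
\<close>

definition election :: "'a set \<Rightarrow> 'a set \<Rightarrow> ('a \<Rightarrow> 'a set) \<Rightarrow> bool" where
  "election X Z B \<longleftrightarrow> finite X \<and> finite Z \<and> (\<forall>x\<in>X. B x \<subseteq> Z)"

definition approvers :: "'a set \<Rightarrow> ('a \<Rightarrow> 'a set) \<Rightarrow> 'a \<Rightarrow> 'a set" where
  "approvers X B c = {x \<in> X. c \<in> B x}"

definition ext :: "'a set \<Rightarrow> ('a \<Rightarrow> 'a set) \<Rightarrow> 'a set \<Rightarrow> nat" where
  "ext X B C = card ((\<Union>c\<in>C. approvers X B c) - C)"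

definition rep_tilde :: "'a set \<Rightarrow> ('a \<Rightarrow> 'a set) \<Rightarrow> 'a set \<Rightarrow> nat" where
  "rep_tilde X B C = card ((\<Union>c\<in>C. approvers X B c) \<union> C)"

definition committees :: "'a set \<Rightarrow> nat \<Rightarrow> 'a set set" where
  "committees Z p = {C. C \<subseteq> Z \<and> card C = p}"

text \<open>
  \<open>greedy X Z B i A\<close> states that \<open>A\<close> is a possible value of the greedy set after \<open>i\<close> steps.
  It is a relation because the maximiser need not be unique; ties may be broken arbitrarily.
\<close>

inductive greedy :: "'a set \<Rightarrow> 'a set \<Rightarrow> ('a \<Rightarrow> 'a set) \<Rightarrow> nat \<Rightarrow> 'a set \<Rightarrow> bool"
  for X Z :: "'a set" and B :: "'a \<Rightarrow> 'a set" where
  greedy_0: "greedy X Z B 0 {}"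
| greedy_Suc: "greedy X Z B i A \<Longrightarrow>
    is_arg_max (\<lambda>c. rep_tilde X B (A \<union> {c})) (\<lambda>c. c \<in> Z - A) c \<Longrightarrow>
    greedy X Z B (Suc i) (A \<union> {c})"

lemma greedy_committee:
  assumes "greedy X Z B p A" and "finite Z"
  shows "A \<in> committees Z p"
  using assms(1)
proof induction
  case greedy_0
  show ?case by (simp add: committees_def)
next
  case (greedy_Suc i A c)
  then have "finite A" using assms(2) by (auto simp: committees_def intro: finite_subset)
  with greedy_Suc show ?case by (auto simp: committees_def is_arg_max_def)
qed

lemma greedy_exists:
  assumes "finite Z" and "p \<le> card Z"
  shows "\<exists>A. greedy X Z B p A"
  using assms(2)
proof (induction p)
  case 0
  show ?case using greedy_0 by blast
next
  case (Suc p)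
  then obtain A where A: "greedy X Z B p A" by auto
  then have AZ: "A \<subseteq> Z" "card A = p"
    using greedy_committee[OF A assms(1)] by (auto simp: committees_def)
  let ?f = "\<lambda>c. rep_tilde X B (A \<union> {c})"
  have fin: "finite (Z - A)" and ne: "Z - A \<noteq> {}"
    using AZ Suc.prems assms(1) by auto
  have "Max (?f ` (Z - A)) \<in> ?f ` (Z - A)" using fin ne by (intro Max_in) auto
  then obtain c where c: "c \<in> Z - A" "?f c = Max (?f ` (Z - A))" by auto
  have "is_arg_max ?f (\<lambda>c. c \<in> Z - A) c"
    unfolding is_arg_max_linorder using c fin by auto
  from greedy_Suc[OF A this] show ?case by (rule exI)
qed

end

theory Submission
  imports Defs
begin

text \<open>
  Let \<open>r\<close> be the value of \<open>ext\<close> at the greedy committee and \<open>m\<close> its maximum over all committees of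
  size \<open>p\<close>. The function \<open>rep_tilde\<close> counts a covered set, so the classical greedy bound gives
  \<open>r + p \<ge> (1 - 1/e) (m + p)\<close>, that is \<open>e r + p \<ge> (e - 1) m\<close>. If every greedy step covers at least
  two new voters, then \<open>r \<ge> p\<close>, and adding the two inequalities gives \<open>(e + 1) r \<ge> (e - 1) m\<close>.
  Otherwise let \<open>A\<close> be the greedy set before the first step that covers at most one new voter. Every
  uncovered voter \<open>x\<close> that can be covered at all approves of a candidate \<open>d \<noteq> x\<close>, which is not in
  \<open>A\<close>. As choosing \<open>d\<close> covers at most one new voter, \<open>d\<close> is already covered, and different \<open>x\<close> have
  different \<open>d\<close>. So at most as many voters are uncovered as are externally represented by \<open>A\<close>, and
  this leads to \<open>r \<ge> m / 2\<close>.
\<close>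

text \<open>This is the set that \<open>rep_tilde\<close> counts. Keeping it as a set lets the gain
  of \<open>c\<close> over \<open>A\<close> be the size of
  \<open>covered X B {c} - covered X B A\<close>.\<close>

definition covered :: "'a set \<Rightarrow> ('a \<Rightarrow> 'a set) \<Rightarrow> 'a set \<Rightarrow> 'a set" where
  "covered X B C = (\<Union>c\<in>C. approvers X B c) \<union> C"

lemma rep_tilde_eq_card_covered: "rep_tilde X B C = card (covered X B C)"
  by (simp add: rep_tilde_def covered_def)

lemma finite_covered: "finite X \<Longrightarrow> finite C \<Longrightarrow> finite (covered X B C)"
  by (auto simp: covered_def approvers_def)

lemma covered_mono: "C \<subseteq> D \<Longrightarrow> covered X B C \<subseteq> covered X B D"
  by (auto simp: covered_def)

lemma covered_eq_UN: "covered X B C = (\<Union>c\<in>C. covered X B {c})"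
  by (auto simp: covered_def)

lemma ext_add_card:
  assumes "finite X" "finite C"
  shows "ext X B C + card C = rep_tilde X B C"
proof -
  have "card (((\<Union>c\<in>C. approvers X B c) - C) \<union> C) = ext X B C + card C"
    unfolding ext_def using assms by (intro card_Un_disjoint) (auto simp: approvers_def)
  then show ?thesis by (simp add: rep_tilde_def)
qed

lemma rep_tilde_insert:
  assumes "finite X" "finite A"
  shows "rep_tilde X B (A \<union> {c}) = rep_tilde X B A + card (covered X B {c} - covered X B A)"
proof -
  have "covered X B (A \<union> {c}) = covered X B A \<union> (covered X B {c} - covered X B A)"
    by (auto simp: covered_def)
  then show ?thesis
    using assms unfolding rep_tilde_eq_card_covered
    by (metis card_Un_disjoint Diff_disjoint finite.emptyI finite.insertI finite_Diff finite_covered)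
qed

text \<open>Greedy compares only candidates outside \<open>A\<close>, but members of
  \<open>A\<close> gain nothing, so \<open>d\<close> may range over all of \<open>Z\<close>. A rival
  committee may thus overlap \<open>A\<close>.\<close>

lemma greedy_gain_max:
  assumes "finite X" "finite A" "d \<in> Z"
    and "is_arg_max (\<lambda>c. rep_tilde X B (A \<union> {c})) (\<lambda>c. c \<in> Z - A) c"
  shows "card (covered X B {d} - covered X B A) \<le> card (covered X B {c} - covered X B A)"
proof (cases "d \<in> A")
  case True
  then have "covered X B {d} \<subseteq> covered X B A" by (intro covered_mono) auto
  then show ?thesis by (simp add: Diff_eq_empty_iff[THEN iffD2])
next
  case False
  then show ?thesis
    using assms(3,4) unfolding is_arg_max_linorder rep_tilde_insert[OF assms(1,2)] by auto
qed

lemma rep_tilde_le_add_mult_gain: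
  assumes "finite X" "finite A" "finite C"
    and "\<And>d. d \<in> C \<Longrightarrow> card (covered X B {d} - covered X B A) \<le> g"
  shows "rep_tilde X B C \<le> rep_tilde X B A + card C * g"
proof -
  have "covered X B C \<subseteq> covered X B A \<union> (\<Union>d\<in>C. covered X B {d} - covered X B A)"
    by (subst covered_eq_UN[of X B C]) auto
  then have "rep_tilde X B C
      \<le> card (covered X B A \<union> (\<Union>d\<in>C. covered X B {d} - covered X B A))"
    unfolding rep_tilde_eq_card_covered
    using assms(1-3) by (intro card_mono) (auto simp: finite_covered)
  also have "\<dots> \<le> rep_tilde X B A + card (\<Union>d\<in>C. covered X B {d} - covered X B A)"
    unfolding rep_tilde_eq_card_covered by (rule card_Un_le)
  also have "card (\<Union>d\<in>C. covered X B {d} - covered X B A)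
      \<le> (\<Sum>d\<in>C. card (covered X B {d} - covered X B A))"
    using assms(3) by (rule card_UN_le)
  also have "\<dots> \<le> card C * g"
    using sum_bounded_above[of C _ g] assms(4) by simp
  finally show ?thesis by simp
qed

text \<open>Some member of \<open>C\<close> gains at least a fraction \<open>1 / p\<close> of what
  \<open>A\<close> lacks compared with \<open>C\<close>. The greedy choice gains no less, so each
  step shrinks the gap by the factor \<open>1 - 1 / p\<close>.\<close>

lemma greedy_gap_bound:
  assumes "greedy X Z B i A" "finite X" "finite Z" "C \<subseteq> Z" "card C = p" "p > 0"
  shows "real (rep_tilde X B C) - real (rep_tilde X B A) \<le> (1 - 1 / p) ^ i * rep_tilde X B C"
  using assms(1)
proof induction
  case greedy_0
  show ?case by simp
next
  case (greedy_Suc i A c)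
  have "finite A"
    using greedy_committee[OF greedy_Suc.hyps(1) \<open>finite Z\<close>] \<open>finite Z\<close>
    by (auto simp: committees_def intro: finite_subset)
  define g where "g = card (covered X B {c} - covered X B A)"
  have next_rep: "rep_tilde X B (A \<union> {c}) = rep_tilde X B A + g"
    unfolding g_def using \<open>finite X\<close> \<open>finite A\<close> by (rule rep_tilde_insert)
  have "rep_tilde X B C \<le> rep_tilde X B A + card C * g"
  proof (rule rep_tilde_le_add_mult_gain)
    show "finite C" using assms(3,4) by (rule rev_finite_subset)
    show "card (covered X B {d} - covered X B A) \<le> g" if "d \<in> C" for d
      unfolding g_def using greedy_gain_max[OF \<open>finite X\<close> \<open>finite A\<close> _ greedy_Suc.hyps(2)] that assms(4)
      by blast
  qed fact+
  then have "real (rep_tilde X B C) \<le> real (rep_tilde X B A) + real p * real g"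
    unfolding assms(5) by (metis of_nat_add of_nat_le_iff of_nat_mult)
  then have "real (rep_tilde X B C) - real (rep_tilde X B A) - g
      \<le> (1 - 1 / p) * (real (rep_tilde X B C) - real (rep_tilde X B A))"
    using \<open>p > 0\<close> by (simp add: field_simps)
  also have "\<dots> \<le> (1 - 1 / p) * ((1 - 1 / p) ^ i * rep_tilde X B C)"
    using greedy_Suc.IH \<open>p > 0\<close> by (intro mult_left_mono) auto
  finally show ?case unfolding next_rep by (simp add: mult.assoc)
qed

lemma greedy_rep_tilde_ratio:
  assumes "greedy X Z B p A" "finite X" "finite Z" "C \<in> committees Z p"
  shows "real (rep_tilde X B A) \<ge> (1 - exp (- 1)) * real (rep_tilde X B C)"
proof (cases "p = 0")
  case True
  then have "C = {}" using assms(3,4) by (auto simp: committees_def dest: rev_finite_subset)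
  then show ?thesis by (simp add: rep_tilde_def)
next
  case False
  \<comment> \<open>This is \<open>1 + x \<le> exp x\<close> at \<open>x = - 1 / p\<close>, raised
    to the power \<open>p\<close>.\<close>
  have "(1 - 1 / real p) ^ p \<le> exp (- 1 / real p) ^ p"
    using False exp_ge_add_one_self[of "- 1 / real p"] by (intro power_mono) auto
  also have "\<dots> = exp (- 1)"
    using False by (simp flip: exp_of_nat_mult)
  finally have "(1 - 1 / real p) ^ p * rep_tilde X B C \<le> exp (- 1) * rep_tilde X B C"
    by (intro mult_right_mono) auto
  moreover have "real (rep_tilde X B C) - rep_tilde X B A \<le> (1 - 1 / p) ^ p * rep_tilde X B C"
    using greedy_gap_bound[OF assms(1-3)] assms(4) False by (auto simp: committees_def)
  ultimately show ?thesis by (simp add: algebra_simps)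
qed

text \<open>If \<open>x\<close> is a candidate, the hypothesis on ballots supplies \<open>d\<close>.
  Otherwise \<open>x\<close> approves of some member of \<open>Z\<close>, which differs from
  \<open>x\<close> because \<open>x\<close> is outside \<open>Z\<close>.\<close>

lemma coverable_approves_other:
  assumes "\<forall>c\<in>Z. \<exists>d\<in>Z. d \<noteq> c \<and> d \<in> B c" "Z \<subseteq> X" "x \<in> covered X B Z"
  shows "\<exists>d\<in>Z. d \<noteq> x \<and> x \<in> approvers X B d"
  using assms by (auto simp: covered_def approvers_def) (metis subsetD)+

lemma small_gain_coverable_bound:
  assumes fin: "finite X" "finite Z" and "A \<subseteq> Z" "Z \<subseteq> X"
    and other: "\<forall>c\<in>Z. \<exists>d\<in>Z. d \<noteq> c \<and> d \<in> B c"
    and gain: "\<And>d. d \<in> Z \<Longrightarrow> card (covered X B {d} - covered X B A) \<le> 1"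
  shows "rep_tilde X B Z + card A \<le> 2 * rep_tilde X B A"
proof -
  let ?cov = "covered X B A" and ?U = "covered X B Z - covered X B A"
  have finA: "finite A" using fin(2) \<open>A \<subseteq> Z\<close> by (rule rev_finite_subset)
  have fin_cov: "finite ?cov" using fin(1) finA by (rule finite_covered)
  have "\<forall>x\<in>?U. \<exists>d\<in>Z. d \<noteq> x \<and> x \<in> approvers X B d"
    using coverable_approves_other[OF other \<open>Z \<subseteq> X\<close>] by blast
  then obtain h where h: "\<And>x. x \<in> ?U \<Longrightarrow> h x \<in> Z \<and> h x \<noteq> x \<and> x \<in> approvers X B (h x)"
    by metis
  have same: "x = y" if "x \<in> covered X B {d} - ?cov" "y \<in> covered X B {d} - ?cov" "d \<in> Z" for x y d
    using gain[OF \<open>d \<in> Z\<close>] that(1,2) card_le_Suc0_iff_eq[of "covered X B {d} - ?cov"]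
      finite_covered[OF fin(1), of "{d}"] by auto
  have "inj_on h ?U"
  proof (rule inj_onI)
    fix x y assume "x \<in> ?U" "y \<in> ?U" "h x = h y"
    \<comment> \<open>Choosing \<open>h x\<close> would newly cover both \<open>x\<close> and
      \<open>y\<close>, but it may cover only one.\<close>
    then show "x = y" using h[of x] h[of y] same[of x "h x" y] by (auto simp: covered_def)
  qed
  moreover have "h ` ?U \<subseteq> ?cov - A"
  proof (rule image_subsetI)
    fix x assume x: "x \<in> ?U"
    have "h x \<notin> A" using h[OF x] x by (auto simp: covered_def)
    moreover have "h x \<in> ?cov"
    proof (rule ccontr)
      assume "h x \<notin> ?cov"
      \<comment> \<open>Since a candidate covers itself, choosing \<open>h x\<close> would newly
        cover the two distinct voters \<open>x\<close> and \<open>h x\<close>.\<close>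
      moreover have "x \<in> covered X B {h x}" "h x \<in> covered X B {h x}"
        using h[OF x] by (auto simp: covered_def)
      ultimately show False using same[of x "h x" "h x"] h[OF x] x by simp
    qed
    ultimately show "h x \<in> ?cov - A" by blast
  qed
  ultimately have "card ?U \<le> card (?cov - A)"
    using fin_cov by (intro card_inj_on_le[of h]) auto
  moreover have "card ?U = rep_tilde X B Z - rep_tilde X B A"
    unfolding rep_tilde_eq_card_covered
    using fin_cov covered_mono[OF \<open>A \<subseteq> Z\<close>] by (rule card_Diff_subset)
  moreover have "card (?cov - A) + card A = rep_tilde X B A"
    using fin_cov finA unfolding rep_tilde_eq_card_covered
    by (metis card_Diff_subset card_mono covered_def le_add_diff_inverse2 sup.cobounded2)
  ultimately show ?thesis by linarith
qed

lemma no_gain_covers_all: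
  assumes "finite X" "A \<subseteq> Z" "\<And>d. d \<in> Z \<Longrightarrow> card (covered X B {d} - covered X B A) = 0"
  shows "rep_tilde X B A = rep_tilde X B Z"
proof -
  have "covered X B {d} \<subseteq> covered X B A" if "d \<in> Z" for d
    using assms(3)[OF that] finite_covered[OF assms(1), of "{d}"] by simp
  then have "covered X B Z \<subseteq> covered X B A"
    by (subst covered_eq_UN) blast
  then have "covered X B A = covered X B Z"
    using covered_mono[OF assms(2)] by (rule subset_antisym[rotated])
  then show ?thesis by (simp add: rep_tilde_eq_card_covered)
qed

text \<open>No first small step has to be singled out: a gain of at most one establishes the second
  alternative afresh, and a gain of at least two preserves whichever alternative held
  before.\<close>

lemma greedy_dichotomy:
  assumes "greedy X Z B i A" and fin: "finite X" "finite Z" and "Z \<subseteq> X"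
    and other: "\<forall>c\<in>Z. \<exists>d\<in>Z. d \<noteq> c \<and> d \<in> B c"
  shows "2 * i \<le> rep_tilde X B A \<or> rep_tilde X B Z + i \<le> 2 * rep_tilde X B A"
  using assms(1)
proof induction
  case greedy_0
  show ?case by simp
next
  case (greedy_Suc i A c)
  have A: "A \<subseteq> Z" "card A = i"
    using greedy_committee[OF greedy_Suc.hyps(1) fin(2)] by (auto simp: committees_def)
  have "finite A" using fin(2) A(1) by (rule rev_finite_subset)
  define g where "g = card (covered X B {c} - covered X B A)"
  have next_rep: "rep_tilde X B (A \<union> {c}) = rep_tilde X B A + g"
    unfolding g_def using fin(1) \<open>finite A\<close> by (rule rep_tilde_insert)
  have gain: "card (covered X B {d} - covered X B A) \<le> g" if "d \<in> Z" for d
    unfolding g_def using fin(1) \<open>finite A\<close> that greedy_Suc.hyps(2) by (rule greedy_gain_max)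
  have step: "A \<union> {c} \<in> committees Z (Suc i)"
    using greedy_committee[OF greedy.greedy_Suc[OF greedy_Suc.hyps] fin(2)] .
  consider "g = 0" | "g = 1" | "g \<ge> 2" by linarith
  then show ?case
  proof cases
    case 1
    then have "rep_tilde X B A = rep_tilde X B Z"
      using gain by (intro no_gain_covers_all fin A) auto
    \<comment> \<open>Committee members count as covered, so \<open>rep_tilde\<close> is at least
      the committee size.\<close>
    moreover have "Suc i \<le> rep_tilde X B (A \<union> {c})"
      using ext_add_card[of X "A \<union> {c}" B] fin(1) \<open>finite A\<close> step by (simp add: committees_def)
    ultimately show ?thesis using 1 next_rep by linarith
  next
    case 2
    have "rep_tilde X B Z + card A \<le> 2 * rep_tilde X B A"
      using gain 2 by (intro small_gain_coverable_bound fin A(1) \<open>Z \<subseteq> X\<close> other) auto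
    then show ?thesis using 2 next_rep A(2) by linarith
  next
    case 3
    then show ?thesis using greedy_Suc.IH unfolding next_rep by auto
  qed
qed

theorem theorem4:
  fixes X Z :: "'a set" and B :: "'a \<Rightarrow> 'a set" and p :: nat and A :: "'a set"
  assumes "election X Z B"
    and "Z \<subseteq> X"
    and "\<forall>c\<in>Z. \<exists>d\<in>Z. d \<noteq> c \<and> d \<in> B c"
    and "p \<le> card Z"
    and "greedy X Z B p A"
  shows "real (ext X B A) \<ge> (exp 1 - 1) / (exp 1 + 1) * real (Max (ext X B ` committees Z p))"
proof -
  have fin: "finite X" "finite Z" using assms(1) by (auto simp: election_def)
  have A: "A \<in> committees Z p" using assms(5) fin(2) by (rule greedy_committee)
  have "finite (committees Z p)" using fin(2) by (simp add: committees_def)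
  then have "Max (ext X B ` committees Z p) \<in> ext X B ` committees Z p"
    using A by (intro Max_in) auto
  then obtain C where C: "C \<in> committees Z p" and m: "Max (ext X B ` committees Z p) = ext X B C"
    by auto
  have rep: "ext X B D + p = rep_tilde X B D" if "D \<in> committees Z p" for D
    using ext_add_card[OF fin(1), of D B] that fin(2)
    by (auto simp: committees_def dest: rev_finite_subset)
  define e :: real where "e = exp 1"
  have e: "0 < e" "e \<le> 3" unfolding e_def using exp_le by auto
  have "(e + 1) * ext X B A \<ge> (e - 1) * ext X B C"
  \<comment> \<open>As \<open>rep_tilde\<close> exceeds \<open>ext\<close> by \<open>p\<close> here,
    the condition says \<open>p \<le> ext X B A\<close>.\<close>
  proof (cases "2 * p \<le> rep_tilde X B A")
    case True
    have "real (ext X B A + p) \<ge> (1 - 1 / e) * real (ext X B C + p)"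
      using greedy_rep_tilde_ratio[OF assms(5) fin C] rep[OF A] rep[OF C]
      by (simp add: e_def exp_minus inverse_eq_divide)
    then have "e * ext X B A + p \<ge> (e - 1) * ext X B C"
      using e(1) by (simp add: field_simps)
    moreover have "real p \<le> ext X B A" using True rep[OF A] by linarith
    ultimately show ?thesis by (simp add: algebra_simps)
  next
    case False
    then have "rep_tilde X B Z + p \<le> 2 * rep_tilde X B A"
      using greedy_dichotomy[OF assms(5) fin assms(2,3)] by blast
    moreover have "rep_tilde X B C \<le> rep_tilde X B Z"
      unfolding rep_tilde_eq_card_covered
      using C fin by (intro card_mono finite_covered covered_mono) (auto simp: committees_def)
    ultimately have half: "real (ext X B C) \<le> 2 * ext X B A"
      using rep[OF A] rep[OF C] by linarith
    \<comment> \<open>The bound \<open>e \<le> 3\<close> is what makes the ratio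
      \<open>1 / 2\<close> at least as good as \<open>(e - 1) / (e + 1)\<close>.\<close>
    have "(e - 1) * ext X B C \<le> (e + 1) / 2 * ext X B C"
      using e(2) by (intro mult_right_mono) auto
    also have "\<dots> \<le> (e + 1) / 2 * (2 * ext X B A)"
      using half e(1) by (intro mult_left_mono) auto
    finally show ?thesis by simp
  qed
  then show ?thesis
    using e(1) unfolding m e_def[symmetric] by (simp add: field_simps)
qed

end
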